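(* For every $k\geq 1$, $\mathsf{TT}^1_k \leq_{\mathrm{W}} \mathsf{D}^2_k$.
   Context: A problem is a partial multivalued function from $\omega^\omega$ to $\omega^\omega$ with nonempty solution sets on its domain (its instances); objects are coded in $\omega^\omega$ via standard codings. $\mathsf{P} \leq_{\mathrm{W}} \mathsf{Q}$ means there are Turing functionals $\Phi,\Psi$ such that for every instance $x$ of $\mathsf{P}$, $\Phi(x)$ is an instance of $\mathsf{Q}$, and for every $\mathsf{Q}$-solution $y$ of $\Phi(x)$, $\Psi(x\oplus y)$ is a $\mathsf{P}$-solution of $x$. $\mathsf{TT}^1_k$: instances are all $f:2^{<\omega}\to k$, solutions all $H\subseteq 2^{<\omega}$ with $(H,\preceq)$ order-isomorphic to $(2^{<\omega},\preceq)$ ($\preceq$ the prefix order) and $f$ constant on $H$. $\mathsf{D}^2_k$ is the jump of $\mathsf{RT}^1_k$: its instances are all functions $g:\omega\times\omega\to k$ such that $\lim_y g(x,y)$ exists for every $x$, and its solutions are all infinite $M\subseteq\omega$ on which the limit coloring $x\mapsto\lim_y g(x,y)$ is constant (equivalently, instances are pairs $(X,h)$ with $h:\omega\to k$ computable from $X'$, given via a limit approximation). *)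

theory Defs
  imports Complex_Main "HOL-Library.Sublist" "HOL-Library.Nat_Bijection"
    "HOL-Library.Indicator_Function"
begin

section \<open>Turing functionals\<close>

text \<open>
  Oracle computations are given by Kleene's partial recursive functions relative to an oracle
  \<open>x\<close>; the programs do not depend on the oracle, so a program is an index of a Turing functional.
  A program applied to an argument list of the wrong length may be undefined; this adds
  no computational power.
\<close>

datatype oprog =
    Zero
  | Succ
  | Proj nat
  | Oracle
  | Comp oprog "oprog list"
  | PrimRec oprog oprog
  | Mu oprog

fun oeval :: "oprog \<Rightarrow> (nat \<Rightarrow> nat) \<Rightarrow> nat list \<Rightarrow> nat option" where
  "oeval Zero x as = Some 0"
| "oeval Succ x as = (case as of [n] \<Rightarrow> Some (Suc n) | _ \<Rightarrow> None)"
| "oeval (Proj i) x as = (if i < length as then Some (as ! i) else None)"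
| "oeval Oracle x as = (case as of [n] \<Rightarrow> Some (x n) | _ \<Rightarrow> None)"
| "oeval (Comp p qs) x as =
     (let vs = map (\<lambda>q. oeval q x as) qs
      in if None \<in> set vs then None else oeval p x (map the vs))"
| "oeval (PrimRec p q) x as =
     (case as of
        [] \<Rightarrow> None
      | n # bs \<Rightarrow> rec_nat (oeval p x bs)
                   (\<lambda>m r. case r of None \<Rightarrow> None | Some v \<Rightarrow> oeval q x (m # v # bs)) n)"
| "oeval (Mu p) x as =
     (if \<exists>n. oeval p x (n # as) = Some 0 \<and> (\<forall>m<n. oeval p x (m # as) \<noteq> None)
      then Some (LEAST n. oeval p x (n # as) = Some 0)
      else None)"

text \<open>The functional with index \<open>p\<close> is defined at \<open>x\<close>, with value \<open>y\<close>, when the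
  computations on all inputs converge.\<close>

definition functional_value :: "oprog \<Rightarrow> (nat \<Rightarrow> nat) \<Rightarrow> (nat \<Rightarrow> nat) \<Rightarrow> bool" where
  "functional_value p x y \<longleftrightarrow> (\<forall>n. oeval p x [n] = Some (y n))"


section \<open>Problems and Weihrauch reducibility\<close>

record problem =
  instances :: "(nat \<Rightarrow> nat) set"
  solutions :: "(nat \<Rightarrow> nat) \<Rightarrow> (nat \<Rightarrow> nat) set"

definition wf_problem :: "problem \<Rightarrow> bool" where
  "wf_problem P \<longleftrightarrow> (\<forall>x \<in> instances P. solutions P x \<noteq> {})"

definition join :: "(nat \<Rightarrow> nat) \<Rightarrow> (nat \<Rightarrow> nat) \<Rightarrow> nat \<Rightarrow> nat" where
  "join x y n = (if even n then x (n div 2) else y (n div 2))"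

definition weihrauch_le :: "problem \<Rightarrow> problem \<Rightarrow> bool" (infix "\<le>\<^sub>W" 50) where
  "P \<le>\<^sub>W Q \<longleftrightarrow>
     (\<exists>\<Phi> \<Psi>. \<forall>x \<in> instances P.
        \<exists>z \<in> instances Q. functional_value \<Phi> x z \<and>
          (\<forall>y \<in> solutions Q z. \<exists>w \<in> solutions P x. functional_value \<Psi> (join x y) w))"


section \<open>The tree pigeonhole principle\<close>

text \<open>Finite binary strings are boolean lists, coded bijectively by natural numbers; subsets of
  \<open>\<omega>\<close> are coded by their 0-1-valued characteristic functions.\<close>

fun string_code :: "bool list \<Rightarrow> nat" where
  "string_code [] = 0"
| "string_code (b # s) = 2 * string_code s + (if b then 2 else 1)"

lemma bij_string_code: "bij string_code"
proof (rule bijI)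
  show "inj string_code"
  proof (rule injI)
    fix s t show "string_code s = string_code t \<Longrightarrow> s = t"
    proof (induction s arbitrary: t)
      case Nil then show ?case by (cases t) (auto split: if_splits)
    next
      case (Cons b s)
      obtain c t' where t: "t = c # t'" using Cons.prems by (cases t) (auto split: if_splits)
      have "b = c \<and> string_code s = string_code t'"
        using Cons.prems unfolding t string_code.simps by (simp split: if_splits) presburger+
      then show ?case using Cons.IH t by blast
    qed
  qed
  have "\<exists>s. string_code s = n" for n
  proof (induction n rule: less_induct)
    case (less n)
    have "n = 0 \<or> n = 2 * ((n - 1) div 2) + 1 \<or> n = 2 * ((n - 2) div 2) + 2"
      by presburger
    then consider "n = 0" | m where "n = 2 * m + 1" | m where "n = 2 * m + 2" by blast
    then show ?case
    proof cases
      case 1 then show ?thesis by (intro exI[of _ "[]"]) simp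
    next
      case 2
      then obtain s where "string_code s = m" using less[of m] by auto
      with 2 show ?thesis by (intro exI[of _ "False # s"]) simp
    next
      case 3
      then obtain s where "string_code s = m" using less[of m] by auto
      with 3 show ?thesis by (intro exI[of _ "True # s"]) simp
    qed
  qed
  then show "surj string_code" by (metis surj_def)
qed

definition full_binary_subtree :: "bool list set \<Rightarrow> bool" where
  "full_binary_subtree H \<longleftrightarrow>
     (\<exists>h. bij_betw h (UNIV :: bool list set) H \<and>
          (\<forall>s t. prefix (h s) (h t) \<longleftrightarrow> prefix s t))"

definition TT1 :: "nat \<Rightarrow> problem" where
  "TT1 k = \<lparr>
     instances = {x. \<forall>s. x (string_code s) < k},
     solutions = (\<lambda>x. {indicator (string_code ` H) | H.
        full_binary_subtree H \<and> (\<exists>i. \<forall>s \<in> H. x (string_code s) = i)})\<rparr>"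


section \<open>The jump of the pigeonhole principle\<close>

definition D2 :: "nat \<Rightarrow> problem" where
  "D2 k = \<lparr>
     instances = {x. (\<forall>a b. x (prod_encode (a, b)) < k) \<and>
                     (\<forall>a. convergent (\<lambda>b. x (prod_encode (a, b))))},
     solutions = (\<lambda>x. {indicator M | M.
        infinite M \<and> (\<exists>i. \<forall>a \<in> M. lim (\<lambda>b. x (prod_encode (a, b))) = i)})\<rparr>"


section \<open>Existence of solutions\<close>

lemma wf_problem_D2: "wf_problem (D2 k)"
  unfolding wf_problem_def
proof
  fix x assume "x \<in> instances (D2 k)"
  then have bd: "x (prod_encode (a, b)) < k" and cv: "convergent (\<lambda>b. x (prod_encode (a, b)))"
    for a b by (simp_all add: D2_def)
  define c where "c a = lim (\<lambda>b. x (prod_encode (a, b)))" for a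
  have "c a < k" for a
  proof -
    have "(\<lambda>b. x (prod_encode (a, b))) \<longlonglongrightarrow> c a"
      unfolding c_def by (rule cv[unfolded convergent_LIMSEQ_iff])
    then have "eventually (\<lambda>b. x (prod_encode (a, b)) = c a) sequentially"
      by (simp add: tendsto_discrete)
    then obtain b where "x (prod_encode (a, b)) = c a"
      by (auto simp: eventually_sequentially)
    then show ?thesis using bd[of a b] by simp
  qed
  then have "finite (range c)" by (intro finite_subset[OF _ finite_lessThan[of k]]) auto
  from pigeonhole_infinite[OF infinite_UNIV_nat this]
  obtain a0 where "infinite {a \<in> UNIV. c a = c a0}" by (rule bexE)
  then have "infinite {a. c a = c a0} \<and> (\<exists>i. \<forall>a \<in> {a. c a = c a0}. c a = i)" by simp
  then have "indicator {a. c a = c a0} \<in> solutions (D2 k) x"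
    unfolding D2_def c_def problem.simps by blast
  then show "solutions (D2 k) x \<noteq> {}" by blast
qed

lemma wf_problem_TT1: "wf_problem (TT1 k)"
  unfolding wf_problem_def
proof
  fix x assume "x \<in> instances (TT1 k)"
  define f where "f s = x (string_code s)" for s
  have f: "f s \<in> {..<k}" for s using \<open>x \<in> _\<close> by (simp add: TT1_def f_def)
  have "\<exists>s i. \<forall>t. prefix s t \<longrightarrow> (\<exists>u. prefix t u \<and> f u = i)"
    if "finite C" "\<forall>s. prefix r s \<longrightarrow> f s \<in> C" for C r
    using that
  proof (induction C arbitrary: r rule: finite_induct)
    case empty then show ?case by (simp, blast)
  next
    case (insert i C)
    show ?case
    proof (cases "\<forall>t. prefix r t \<longrightarrow> (\<exists>u. prefix t u \<and> f u = i)")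
      case False
      then obtain t where "prefix r t" "\<forall>u. prefix t u \<longrightarrow> f u \<noteq> i" by blast
      then have "\<forall>u. prefix t u \<longrightarrow> f u \<in> C"
        using insert.prems prefix_order.order_trans[of r t] by blast
      then show ?thesis by (rule insert.IH)
    qed blast
  qed
  from this[OF finite_lessThan, of "[]" k] f obtain s0 i
    where "\<forall>t. prefix s0 t \<longrightarrow> (\<exists>u. prefix t u \<and> f u = i)" by blast
  then obtain e where e: "\<And>t. prefix s0 t \<Longrightarrow> prefix t (e t) \<and> f (e t) = i" by metis
  define g where "g = rec_list (e s0) (\<lambda>b _ r. e (r @ [b]))"
  define h where "h s = g (rev s)" for s
  have h0: "h [] = e s0" and h1: "h (s @ [b]) = e (h s @ [b])" for s b
    by (simp_all add: h_def g_def)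
  have hs: "prefix s0 (h s) \<and> f (h s) = i" for s
  proof (induction s rule: rev_induct)
    case Nil then show ?case using e[of s0] by (simp add: h0)
  next
    case (snoc b s)
    then have "prefix s0 (h s @ [b])" by (simp add: prefix_prefix)
    with e[OF this] show ?case unfolding h1 using prefix_order.order_trans[of s0] by blast
  qed
  have hb: "prefix (h s @ [b]) (h (s @ [b]))" for s b
    unfolding h1 using e[of "h s @ [b]"] hs[of s] by (simp add: prefix_prefix)
  have mono: "prefix (h s) (h (s @ t))" for s t
  proof (induction t rule: rev_induct)
    case (snoc b t)
    have "prefix (h (s @ t)) (h (s @ t @ [b]))"
      using append_prefixD[OF hb[of "s @ t" b]] by simp
    with snoc.IH show ?case by (rule prefix_order.order_trans)
  qed simp
  have step: "prefix (h s @ [b]) (h (s @ b # t))" for s b t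
    using prefix_order.order_trans[OF hb[of s b] mono[of "s @ [b]" t]] by simp
  have iso: "prefix (h s) (h t) \<longleftrightarrow> prefix s t" for s t
  proof
    assume "prefix s t" then show "prefix (h s) (h t)" using mono by (auto simp: prefix_def)
  next
    assume a: "prefix (h s) (h t)"
    show "prefix s t"
    proof (rule ccontr)
      assume n: "\<not> prefix s t"
      show False
      proof (cases "prefix t s")
        case True
        with n obtain b u where s: "s = t @ b # u" by (auto simp: prefix_def neq_Nil_conv)
        have "prefix (h t @ [b]) (h t)"
          by (rule prefix_order.order_trans[OF step[of t b u] a[unfolded s]])
        then show False using prefix_length_le[of "h t @ [b]" "h t"] by simp
      next
        case False
        with n have "s \<parallel> t" by blast
        from parallel_decomp[OF this] obtain p b c u v
          where "b \<noteq> c" and s: "s = p @ b # u" and t: "t = p @ c # v" by blast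
        have "prefix (h p @ [b]) (h t)"
          by (rule prefix_order.order_trans[OF step[of p b u] a[unfolded s]])
        moreover have "prefix (h p @ [c]) (h t)" using step[of p c v] unfolding t .
        ultimately show False using \<open>b \<noteq> c\<close> by (auto simp: prefix_def)
      qed
    qed
  qed
  have "inj h"
  proof (rule injI)
    fix s t assume "h s = h t"
    then have "prefix s t" "prefix t s" using iso[of s t] iso[of t s] by simp_all
    then show "s = t" by (rule prefix_order.antisym)
  qed
  then have "bij_betw h UNIV (range h)" by (rule inj_on_imp_bij_betw)
  then have "full_binary_subtree (range h)"
    unfolding full_binary_subtree_def using iso by blast
  moreover have "\<forall>s \<in> range h. x (string_code s) = i" using hs by (auto simp: f_def)
  ultimately have "indicator (string_code ` range h) \<in> solutions (TT1 k) x"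
    unfolding TT1_def by auto
  then show "solutions (TT1 k) x \<noteq> {}" by blast
qed

end

theory Submission
  imports Defs
begin

text \<open>
  Fix a colouring \<open>f\<close> of the binary strings. If \<open>b\<close> is a string such that no extension of \<open>b\<close> has
  fewer colours above it than \<open>b\<close>, then every colour occurring above \<open>b\<close> is dense above \<open>b\<close>. Hence
  for any \<open>r\<close> extending \<open>b\<close>, a monochromatic copy of the full binary tree is found by greedy search
  above \<open>r\<close> for the colour of \<open>r\<close> itself, and it suffices to compute some extension of such a \<open>b\<close>.

  A walk through all strings moves to the current string whenever that string extends the position
  and has fewer colours above it. With the true colour counts the walk ends in a suitable \<open>b\<close>. With
  only the colours seen by stage \<open>y\<close>, it yields a computable sequence of strings \<open>r y\<close>, which
  eventually extend \<open>b\<close>, but no \<open>y\<close> can be recognised as being late enough. The \<open>D2\<close>-instance gives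
  \<open>y\<close> the least number (minus one) of colours above a point of the true walk that lies below
  \<open>r y\<close>. This limit colour is eventually constant, and it attains its eventual value only at those
  \<open>y\<close> for which \<open>r y\<close> extends \<open>b\<close>. Thus any element \<open>y\<close> of any \<open>D2\<close>-solution provides a correct
  \<open>r y\<close>.
\<close>

section \<open>Total computable functions with an oracle\<close>

definition computable :: "nat \<Rightarrow> ((nat \<Rightarrow> nat) \<Rightarrow> nat list \<Rightarrow> nat) \<Rightarrow> bool" where
  "computable n F \<longleftrightarrow> (\<exists>p. \<forall>x v. length v = n \<longrightarrow> oeval p x v = Some (F x v))"

lemma computable_nth: "i < n \<Longrightarrow> computable n (\<lambda>x v. v ! i)"
  unfolding computable_def by (intro exI[of _ "Proj i"]) simp

lemma computable_cong:
  "(\<And>x v. length v = n \<Longrightarrow> F x v = G x v) \<Longrightarrow> computable n F \<longleftrightarrow> computable n G"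
  unfolding computable_def by metis

lemma computable_hd_funpow: "i < n \<Longrightarrow> computable n (\<lambda>x v. hd ((tl ^^ i) v))"
proof -
  assume i: "i < n"
  have "(tl ^^ i) v = drop i v" for v :: "nat list" by (induction i) (simp_all add: drop_Suc drop_tl)
  then have "hd ((tl ^^ i) v) = v ! i" if "length v = n" for v :: "nat list"
    using that i by (simp add: hd_drop_conv_nth)
  then show ?thesis using computable_nth[OF i] by (simp cong: computable_cong)
qed

text \<open>Arguments are addressed as \<open>hd (tl ... (tl v))\<close>, so that a binder pushes its variable
  onto the list and all closure rules below have higher-order pattern conclusions.\<close>

lemma computable_hd:
  "computable (Suc n) (\<lambda>x v. hd v)"
  "computable (Suc (Suc n)) (\<lambda>x v. hd (tl v))"
  "computable (Suc (Suc (Suc n))) (\<lambda>x v. hd (tl (tl v)))"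
  "computable (Suc (Suc (Suc (Suc n)))) (\<lambda>x v. hd (tl (tl (tl v))))"
  "computable (Suc (Suc (Suc (Suc (Suc n))))) (\<lambda>x v. hd (tl (tl (tl (tl v)))))"
  "computable (Suc (Suc (Suc (Suc (Suc (Suc n)))))) (\<lambda>x v. hd (tl (tl (tl (tl (tl v))))))"
  "computable (Suc (Suc (Suc (Suc (Suc (Suc (Suc n))))))) (\<lambda>x v. hd (tl (tl (tl (tl (tl (tl v)))))))"
  "computable (Suc (Suc (Suc (Suc (Suc (Suc (Suc (Suc n))))))))
    (\<lambda>x v. hd (tl (tl (tl (tl (tl (tl (tl v))))))))"
  using computable_hd_funpow[of 0 "Suc n"]
    computable_hd_funpow[of 1 "Suc (Suc n)"]
    computable_hd_funpow[of 2 "Suc (Suc (Suc n))"]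
    computable_hd_funpow[of 3 "Suc (Suc (Suc (Suc n)))"]
    computable_hd_funpow[of 4 "Suc (Suc (Suc (Suc (Suc n))))"]
    computable_hd_funpow[of 5 "Suc (Suc (Suc (Suc (Suc (Suc n)))))"]
    computable_hd_funpow[of 6 "Suc (Suc (Suc (Suc (Suc (Suc (Suc n))))))"]
    computable_hd_funpow[of 7 "Suc (Suc (Suc (Suc (Suc (Suc (Suc (Suc n)))))))"]
  by (simp_all add: numeral_eq_Suc)

lemma computable_Comp:
  assumes "computable (length Gs) F" "\<And>G. G \<in> set Gs \<Longrightarrow> computable n G"
  shows "computable n (\<lambda>x v. F x (map (\<lambda>G. G x v) Gs))"
proof -
  obtain p where p: "\<And>x v. length v = length Gs \<Longrightarrow> oeval p x v = Some (F x v)"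
    using assms(1) unfolding computable_def by blast
  obtain q where q: "\<And>G x v. G \<in> set Gs \<Longrightarrow> length v = n \<Longrightarrow> oeval (q G) x v = Some (G x v)"
    using assms(2) unfolding computable_def by metis
  have "map (\<lambda>r. oeval r x v) (map q Gs) = map (\<lambda>G. Some (G x v)) Gs" if "length v = n" for x v
    using q that by simp
  then have "oeval (Comp p (map q Gs)) x v = Some (F x (map (\<lambda>G. G x v) Gs))"
    if "length v = n" for x v
    using that p[of "map (\<lambda>G. G x v) Gs" x] by (auto simp: Let_def comp_def q cong: map_cong)
  then show ?thesis unfolding computable_def by blast
qed

text \<open>Separates compound arguments from the body: once they are list entries, the pattern
  rules apply under the body's binders.\<close>

lemma computable_comp1:
  assumes "computable (Suc 0) (\<lambda>x v. F x (hd v))" "computable n A"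
  shows "computable n (\<lambda>x v. F x (A x v))"
  using computable_Comp[of "[A]" "\<lambda>x v. F x (hd v)" n] assms by simp

lemma computable_comp2:
  assumes "computable (Suc (Suc 0)) (\<lambda>x v. F x (hd v) (hd (tl v)))"
    "computable n A" "computable n B"
  shows "computable n (\<lambda>x v. F x (A x v) (B x v))"
  using computable_Comp[of "[A, B]" "\<lambda>x v. F x (hd v) (hd (tl v))" n] assms by auto

lemma computable_comp3:
  assumes "computable (Suc (Suc (Suc 0))) (\<lambda>x v. F x (hd v) (hd (tl v)) (hd (tl (tl v))))"
    "computable n A" "computable n B" "computable n C"
  shows "computable n (\<lambda>x v. F x (A x v) (B x v) (C x v))"
  using computable_Comp[of "[A, B, C]" "\<lambda>x v. F x (hd v) (hd (tl v)) (hd (tl (tl v)))" n] assms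
  by auto

lemma computable_oracle: "computable n A \<Longrightarrow> computable n (\<lambda>x v. x (A x v))"
  by (rule computable_comp1[where F = "\<lambda>x. x"])
    (auto simp: computable_def length_Suc_conv intro!: exI[of _ Oracle])

lemma computable_Suc: "computable n A \<Longrightarrow> computable n (\<lambda>x v. Suc (A x v))"
  by (rule computable_comp1[where F = "\<lambda>x. Suc"])
    (auto simp: computable_def length_Suc_conv intro!: exI[of _ Succ])

lemma computable_0: "computable n (\<lambda>x v. 0)"
  by (auto simp: computable_def intro!: exI[of _ Zero])

lemma computable_const: "computable n (\<lambda>x v. c)"
  by (induction c) (auto intro: computable_0 computable_Suc)

lemma computable_rec_nat:
  assumes A: "computable n A" and N: "computable n N"
    and S: "computable (Suc (Suc n)) (\<lambda>x v. S x (hd v) (hd (tl v)) (tl (tl v)))"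
  shows "computable n (\<lambda>x v. rec_nat (A x v) (\<lambda>m r. S x m r v) (N x v))"
proof -
  obtain p where p: "\<And>x v. length v = n \<Longrightarrow> oeval p x v = Some (A x v)"
    using A unfolding computable_def by blast
  obtain q where q: "\<And>x v. length v = Suc (Suc n) \<Longrightarrow>
      oeval q x v = Some (S x (hd v) (hd (tl v)) (tl (tl v)))"
    using S unfolding computable_def by blast
  have rec: "oeval (PrimRec p q) x (m # v) = Some (rec_nat (A x v) (\<lambda>m r. S x m r v) m)"
    if "length v = n" for x m v
    by (induction m) (simp_all add: p q that)
  \<comment> \<open>\<open>PrimRec\<close> recurses on the head of its argument list; composing with
    \<open>N\<close> and the projections yields recursion up to \<open>N x v\<close> with the
    parameters \<open>v\<close> kept.\<close>
  define F where "F x w = rec_nat (A x (tl w)) (\<lambda>m r. S x m r (tl w)) (hd w)" for x w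
  define Gs where "Gs = N # map (\<lambda>i x v. v ! i) [0..<n]"
  have "computable (length Gs) F"
    unfolding computable_def F_def Gs_def using rec
    by (intro exI[of _ "PrimRec p q"]) (auto simp: length_Suc_conv)
  moreover have "computable n G" if "G \<in> set Gs" for G
    using that N by (auto simp: Gs_def computable_nth)
  ultimately have "computable n (\<lambda>x v. F x (map (\<lambda>G. G x v) Gs))"
    by (rule computable_Comp)
  moreover have "F x (map (\<lambda>G. G x v) Gs) = rec_nat (A x v) (\<lambda>m r. S x m r v) (N x v)"
    if "length v = n" for x v
    using that map_nth[of v] by (simp add: F_def Gs_def comp_def)
  ultimately show ?thesis by (simp cong: computable_cong)
qed

section \<open>Arithmetic and bounded sums\<close>

lemma computable_add:
  assumes "computable n A" "computable n B"
  shows "computable n (\<lambda>x v. A x v + B x v)"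
proof (rule computable_comp2[OF _ assms])
  have "a + b = rec_nat a (\<lambda>m r. Suc r) b" for a b
    by (induction b) simp_all
  then show "computable (Suc (Suc 0)) (\<lambda>x v. hd v + hd (tl v))"
    by (simp only:) (intro computable_rec_nat computable_hd computable_Suc)
qed

lemma computable_diff:
  assumes "computable n A" "computable n B"
  shows "computable n (\<lambda>x v. A x v - B x v)"
proof (rule computable_comp2[OF _ assms])
  have *: "a - 1 = rec_nat 0 (\<lambda>m r. m) a" for a :: nat
    by (cases a) simp_all
  have pred: "computable (Suc 0) (\<lambda>x v. hd v - 1)"
    unfolding * by (intro computable_rec_nat computable_hd computable_0)
  have "a - b = rec_nat a (\<lambda>m r. r - 1) b" for a b :: nat
    by (induction b) simp_all
  then have "(\<lambda>x v. hd v - hd (tl v)) =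
      (\<lambda>(x :: nat \<Rightarrow> nat) v. rec_nat (hd v) (\<lambda>m r. r - 1) (hd (tl v) :: nat))"
    by blast
  moreover have "computable (Suc (Suc 0)) (\<lambda>x v. rec_nat (hd v) (\<lambda>m r. r - 1) (hd (tl v)))"
    by (intro computable_rec_nat computable_hd computable_comp1[OF pred])
  ultimately show "computable (Suc (Suc 0)) (\<lambda>x v. hd v - hd (tl v))"
    by (simp only:)
qed

text \<open>Lets a function of one bound variable and the parameters ignore a variable bound in
  between, such as the accumulator of a recursion.\<close>

lemma computable_skip:
  assumes "computable (Suc n) (\<lambda>x v. F x (hd v) (tl v))"
  shows "computable (Suc (Suc n)) (\<lambda>x v. F x (hd v) (tl (tl v)))"
proof -
  define Gs :: "((nat \<Rightarrow> nat) \<Rightarrow> nat list \<Rightarrow> nat) list"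
    where "Gs = map (\<lambda>i x v. v ! i) (0 # [2..<Suc (Suc n)])"
  have "computable (Suc (Suc n)) (\<lambda>x v. F x (hd (map (\<lambda>G. G x v) Gs)) (tl (map (\<lambda>G. G x v) Gs)))"
    by (rule computable_Comp[where F = "\<lambda>x v. F x (hd v) (tl v)"])
      (use assms in \<open>auto simp: Gs_def intro: computable_nth simp del: upt_Suc\<close>)
  moreover have "map (\<lambda>G. G x v) Gs = hd v # tl (tl v)" if "length v = Suc (Suc n)"
    for x :: "nat \<Rightarrow> nat" and v :: "nat list"
    using that by (auto simp: Gs_def length_Suc_conv comp_def simp del: upt_Suc
        intro!: nth_equalityI)
  ultimately show ?thesis by (simp cong: computable_cong)
qed

lemma computable_sum:
  assumes N: "computable n N" and F: "computable (Suc n) (\<lambda>x v. F x (hd v) (tl v))"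
  shows "computable n (\<lambda>x v. \<Sum>m<N x v. F x m v)"
proof -
  have "(\<Sum>m<N. g m) = rec_nat 0 (\<lambda>m r. r + g m) N" for N and g :: "nat \<Rightarrow> nat"
    by (induction N) simp_all
  then show ?thesis
    by (simp only:) (intro computable_rec_nat computable_hd computable_0 computable_add N computable_skip[OF F])
qed

lemmas computable_intros = computable_hd computable_oracle computable_Suc computable_const
  computable_add computable_diff computable_sum

lemma computable_mult:
  assumes "computable n A" "computable n B"
  shows "computable n (\<lambda>x v. A x v * B x v)"
proof (rule computable_comp2[OF _ assms])
  have "computable (Suc (Suc 0)) (\<lambda>x v. \<Sum>m<hd v. hd (tl v))"
    by (intro computable_intros)
  then show "computable (Suc (Suc 0)) (\<lambda>x v. hd v * hd (tl v))" by simp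
qed

section \<open>Truth values, bounded quantifiers and bounded search\<close>

lemma computable_not:
  assumes "computable n (\<lambda>x v. of_bool (P x v))"
  shows "computable n (\<lambda>x v. of_bool (\<not> P x v))"
proof -
  have "computable n (\<lambda>x v. 1 - of_bool (P x v))"
    by (intro computable_intros assms)
  moreover have "1 - of_bool P = (of_bool (\<not> P) :: nat)" for P by simp
  ultimately show ?thesis by simp
qed

lemma computable_conj:
  "computable n (\<lambda>x v. of_bool (P x v)) \<Longrightarrow> computable n (\<lambda>x v. of_bool (Q x v)) \<Longrightarrow>
    computable n (\<lambda>x v. of_bool (P x v \<and> Q x v))"
  by (simp only: of_bool_conj) (intro computable_mult)

lemma computable_disj:
  assumes "computable n (\<lambda>x v. of_bool (P x v))" "computable n (\<lambda>x v. of_bool (Q x v))"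
  shows "computable n (\<lambda>x v. of_bool (P x v \<or> Q x v))"
  using computable_not[OF computable_conj[OF assms[THEN computable_not]]] by simp

lemma computable_imp:
  assumes "computable n (\<lambda>x v. of_bool (P x v))" "computable n (\<lambda>x v. of_bool (Q x v))"
  shows "computable n (\<lambda>x v. of_bool (P x v \<longrightarrow> Q x v))"
  using computable_disj[OF computable_not[OF assms(1)] assms(2)] by (simp only: imp_conv_disj)

lemma computable_le:
  assumes "computable n A" "computable n B"
  shows "computable n (\<lambda>x v. of_bool (A x v \<le> B x v))"
proof -
  have "computable n (\<lambda>x v. 1 - (A x v - B x v))"
    by (intro computable_intros assms)
  moreover have "1 - (a - b) = of_bool (a \<le> b)" for a b :: nat by simp
  ultimately show ?thesis by simp
qed

lemma computable_less:
  assumes "computable n A" "computable n B"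
  shows "computable n (\<lambda>x v. of_bool (A x v < B x v))"
  using computable_le[OF computable_Suc[OF assms(1)] assms(2)] by (simp only: Suc_le_eq)

lemma computable_eq:
  assumes "computable n A" "computable n B"
  shows "computable n (\<lambda>x v. of_bool (A x v = B x v))"
  using computable_conj[OF computable_le[OF assms] computable_le[OF assms(2,1)]]
  by (simp only: order_eq_iff)

lemma computable_bex:
  assumes N: "computable n N" and P: "computable (Suc n) (\<lambda>x v. of_bool (P x (hd v) (tl v)))"
  shows "computable n (\<lambda>x v. of_bool (\<exists>m<N x v. P x m v))"
proof -
  have "(\<exists>m<N. Q m) \<longleftrightarrow> 0 < (\<Sum>m<N. of_bool (Q m) :: nat)" for N :: nat and Q
    unfolding neq0_conv[symmetric] by auto
  then show ?thesis
    by (simp only:) (intro computable_less computable_sum[OF N P] computable_const)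
qed

lemma computable_ball:
  assumes N: "computable n N" and P: "computable (Suc n) (\<lambda>x v. of_bool (P x (hd v) (tl v)))"
  shows "computable n (\<lambda>x v. of_bool (\<forall>m<N x v. P x m v))"
proof -
  have "(\<forall>m<N. Q m) \<longleftrightarrow> \<not> (\<exists>m<N. \<not> Q m)" for N :: nat and Q by auto
  then show ?thesis
    by (simp only:) (intro computable_not computable_bex N P)
qed

lemma computable_If:
  assumes "computable n (\<lambda>x v. of_bool (P x v))" "computable n A" "computable n B"
  shows "computable n (\<lambda>x v. if P x v then A x v else B x v)"
proof -
  have "computable n (\<lambda>x v. of_bool (P x v) * A x v + of_bool (\<not> P x v) * B x v)"
    by (intro computable_add computable_mult computable_not assms)
  moreover have "of_bool P * a + of_bool (\<not> P) * b = (if P then a else b)" for P and a b :: nat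
    by simp
  ultimately show ?thesis by simp
qed

text \<open>The alternative \<open>m = N x v\<close> makes the search total: failure returns the
  bound.\<close>

lemma computable_Least:
  assumes N: "computable n N" and P: "computable (Suc n) (\<lambda>x v. of_bool (P x (hd v) (tl v)))"
  shows "computable n (\<lambda>x v. LEAST m. m = N x v \<or> P x m v)"
proof -
  \<comment> \<open>The result of the search is the number of \<open>m < b\<close> such that no
    witness is at most \<open>m\<close>.\<close>
  have eq: "(LEAST m. m = b \<or> Q m) = (\<Sum>m<b. of_bool (\<forall>i<Suc m. \<not> Q i))" for b and Q :: "nat \<Rightarrow> bool"
  proof -
    define l where "l = (LEAST m. m = b \<or> Q m)"
    have l: "l = b \<or> Q l" unfolding l_def by (rule LeastI_ex) blast
    have less: "\<not> Q m" if "m < l" for m using not_less_Least[OF that[unfolded l_def]] by blast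
    have "l \<le> b" unfolding l_def by (rule Least_le) blast
    have "(\<forall>i<Suc m. \<not> Q i) \<longleftrightarrow> m < l" if "m < b" for m
    proof
      assume "\<forall>i<Suc m. \<not> Q i"
      moreover have "\<not> l < Suc m" if "\<not> Q l" using l that \<open>m < b\<close> by simp
      ultimately have "\<not> l < Suc m" by blast
      then show "m < l" by simp
    next
      assume "m < l"
      then show "\<forall>i<Suc m. \<not> Q i" using less by simp
    qed
    then have "(\<Sum>m<b. of_bool (\<forall>i<Suc m. \<not> Q i)) = (\<Sum>m<b. of_bool (m < l) :: nat)"
      by (intro sum.cong) auto
    also have "\<dots> = card ({..<b} \<inter> {..<l})" by (simp add: sum_of_bool_eq lessThan_def)
    also have "{..<b} \<inter> {..<l} = {..<l}" using \<open>l \<le> b\<close> by auto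
    finally show ?thesis by (simp add: l_def)
  qed
  have Q: "computable (Suc n) (\<lambda>x v. of_bool (\<forall>i<Suc (hd v). \<not> P x i (tl v)))"
    by (intro computable_ball computable_not computable_Suc computable_hd
        computable_skip[where F = "\<lambda>x i v. of_bool (P x i v)"] P)
  show ?thesis unfolding eq by (intro computable_sum N Q)
qed

lemma computable_power:
  assumes "computable n A" shows "computable n (\<lambda>x v. 2 ^ A x v :: nat)"
proof (rule computable_comp1[OF _ assms])
  have "(2 :: nat) ^ a = rec_nat 1 (\<lambda>m r. r + r) a" for a by (induction a) simp_all
  then show "computable (Suc 0) (\<lambda>x v. 2 ^ hd v)"
    by (simp only:) (intro computable_rec_nat computable_intros)
qed

lemmas computable_logic = computable_intros computable_mult computable_not computable_conj
  computable_disj computable_imp computable_le computable_less computable_eq computable_bex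
  computable_ball computable_If computable_Least computable_power

section \<open>Pairing and unbounded search\<close>

lemma computable_prod_encode:
  assumes "computable n A" "computable n B"
  shows "computable n (\<lambda>x v. prod_encode (A x v, B x v))"
proof -
  have "triangle a = (\<Sum>i<a. Suc i)" for a by (induction a) simp_all
  then show ?thesis
    unfolding prod_encode_def by simp (intro computable_logic assms computable_comp2[OF _ assms])
qed

text \<open>Neither component exceeds the code, so the double sum meets the coded pair, and by
  injectivity no other pair contributes.\<close>

lemma prod_decode_sums:
  "fst (prod_decode n) = (\<Sum>a<Suc n. \<Sum>b<Suc n. of_bool (prod_encode (a, b) = n) * a)" (is "_ = ?a")
  "snd (prod_decode n) = (\<Sum>a<Suc n. \<Sum>b<Suc n. of_bool (prod_encode (a, b) = n) * b)" (is "_ = ?b")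
proof -
  obtain c d where n: "prod_decode n = (c, d)" by (cases "prod_decode n")
  then have cd: "n = prod_encode (c, d)" by (metis prod_decode_inverse)
  then have le: "c < Suc n" "d < Suc n" using le_prod_encode_1 le_prod_encode_2 less_Suc_eq_le by metis+
  have eq: "prod_encode (a, b) = n \<longleftrightarrow> a = c \<and> b = d" for a b
    unfolding cd using inj_prod_encode[of UNIV] by (auto simp: inj_on_def)
  have sums: "(\<Sum>a<Suc n. \<Sum>b<Suc n. of_bool (prod_encode (a, b) = n) * w a b) = w c d"
    for w :: "nat \<Rightarrow> nat \<Rightarrow> nat"
  proof -
    have "(\<Sum>b<Suc n. of_bool (prod_encode (a, b) = n) * w a b) = (if a = c then w c d else 0)" for a
    proof -
      have "(\<Sum>b<Suc n. of_bool (prod_encode (a, b) = n) * w a b) =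
          (\<Sum>b<Suc n. if b = d then of_bool (a = c) * w a b else 0)"
        by (intro sum.cong) (auto simp: eq)
      then show ?thesis using le by (simp add: sum.delta del: sum.lessThan_Suc)
    qed
    then show ?thesis using le by (simp add: sum.delta del: sum.lessThan_Suc)
  qed
  show "fst (prod_decode n) = ?a" "snd (prod_decode n) = ?b"
    unfolding n using sums[of "\<lambda>a b. a"] sums[of "\<lambda>a b. b"] by (simp_all only: fst_conv snd_conv)
qed

lemma computable_prod_decode:
  assumes "computable n A"
  shows "computable n (\<lambda>x v. fst (prod_decode (A x v)))" "computable n (\<lambda>x v. snd (prod_decode (A x v)))"
proof -
  have "computable (Suc 0) (\<lambda>x v. fst (prod_decode (hd v)))"
    unfolding prod_decode_sums by (intro computable_logic computable_prod_encode)
  then show "computable n (\<lambda>x v. fst (prod_decode (A x v)))"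
    by (rule computable_comp1[OF _ assms])
  have "computable (Suc 0) (\<lambda>x v. snd (prod_decode (hd v)))"
    unfolding prod_decode_sums by (intro computable_logic computable_prod_encode)
  then show "computable n (\<lambda>x v. snd (prod_decode (A x v)))"
    by (rule computable_comp1[OF _ assms])
qed

lemma partial_Least:
  assumes P: "computable (Suc n) (\<lambda>x v. of_bool (P x (hd v) (tl v)))"
    and G: "computable (Suc n) (\<lambda>x v. G x (hd v) (tl v))"
  shows "\<exists>p. \<forall>x v. length v = n \<longrightarrow> (\<exists>m. P x m v) \<longrightarrow> oeval p x v = Some (G x (LEAST m. P x m v) v)"
proof -
  \<comment> \<open>\<open>Mu\<close> searches for the value 0, so \<open>p\<close> decides the
    negation; as \<open>p\<close> is total, all earlier values are defined.\<close>
  obtain p where p: "\<And>x v. length v = Suc n \<Longrightarrow> oeval p x v = Some (of_bool (\<not> P x (hd v) (tl v)))"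
    using computable_not[OF P] unfolding computable_def by blast
  obtain g where g: "\<And>x v. length v = Suc n \<Longrightarrow> oeval g x v = Some (G x (hd v) (tl v))"
    using G unfolding computable_def by blast
  have "oeval (Comp g (Mu p # map Proj [0..<n])) x v = Some (G x (LEAST m. P x m v) v)"
    if v: "length v = n" and ex: "\<exists>m. P x m v" for x v
  proof -
    have "oeval (Mu p) x v = Some (LEAST m. P x m v)"
      using v ex by (simp add: p)
    moreover have "map (\<lambda>q. oeval q x v) (map Proj [0..<n]) = map Some v"
      using v by (auto intro!: nth_equalityI)
    ultimately have "map (\<lambda>q. oeval q x v) (Mu p # map Proj [0..<n]) = map Some ((LEAST m. P x m v) # v)"
      by simp
    then show ?thesis using v by (simp only: oeval.simps(5) Let_def) (simp add: g comp_def)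
  qed
  then show ?thesis by blast
qed

section \<open>Prefixes on string codes\<close>

lemma decode_string_code: "inv string_code (string_code s) = s"
  using bij_string_code by (simp add: bij_def)

lemma string_code_decode: "string_code (inv string_code n) = n"
  using bij_string_code by (simp add: bij_def surj_f_inv_f)

text \<open>\<open>string_code\<close> is bijective base-2 notation (digits 1 and 2), least
  significant digit first, so an appended string is shifted by the length of
  \<open>s\<close>.\<close>

lemma string_code_append: "string_code (s @ t) = string_code s + 2 ^ length s * string_code t"
  by (induction s) (simp_all add: algebra_simps)

text \<open>Strings of equal length occupy one block of codes, so the size of a code determines the
  length.\<close>

lemma string_code_bounds:
  "2 ^ length s \<le> Suc (string_code s)" "Suc (string_code s) < 2 * 2 ^ length s"
  by (induction s) auto

lemma length_le_string_code: "length s \<le> string_code s"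
  by (induction s) auto

definition code_prefix :: "nat \<Rightarrow> nat \<Rightarrow> bool" where
  "code_prefix a b \<longleftrightarrow> prefix (inv string_code a) (inv string_code b)"

lemma code_prefix_refl: "code_prefix a a"
  and code_prefix_trans: "code_prefix a b \<Longrightarrow> code_prefix b c \<Longrightarrow> code_prefix a c"
  by (auto simp: code_prefix_def intro: prefix_order.order_trans)

lemma code_prefix_0: "code_prefix 0 a"
  using decode_string_code[of "[]"] by (simp add: code_prefix_def)

lemma code_prefix_string_code: "code_prefix (string_code s) (string_code t) \<longleftrightarrow> prefix s t"
  by (simp add: code_prefix_def decode_string_code)

text \<open>Makes prefixes decidable by bounded quantifiers: \<open>l\<close> is forced to be the
  length of the string coded by \<open>a\<close>, and \<open>t\<close> codes the rest of the string
  of \<open>b\<close>.\<close>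

lemma code_prefix_arith:
  "code_prefix a b \<longleftrightarrow> (\<exists>l<Suc a. \<exists>t<Suc b. 2 ^ l \<le> Suc a \<and> Suc a < 2 * 2 ^ l \<and> b = a + 2 ^ l * t)"
proof -
  obtain s where s: "a = string_code s" by (metis string_code_decode)
  show ?thesis
  proof
    assume "code_prefix a b"
    then obtain u where "inv string_code b = s @ u"
      unfolding code_prefix_def s decode_string_code by (auto elim: prefixE)
    then have b: "b = a + 2 ^ length s * string_code u"
      by (metis s string_code_append string_code_decode)
    moreover have "string_code u \<le> 2 ^ length s * string_code u" by simp
    ultimately have "string_code u < Suc b" by linarith
    moreover have "length s < Suc a" using length_le_string_code[of s] s by simp
    ultimately show "\<exists>l<Suc a. \<exists>t<Suc b. 2 ^ l \<le> Suc a \<and> Suc a < 2 * 2 ^ l \<and> b = a + 2 ^ l * t"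
      using b string_code_bounds[of s] s by blast
  next
    assume "\<exists>l<Suc a. \<exists>t<Suc b. 2 ^ l \<le> Suc a \<and> Suc a < 2 * 2 ^ l \<and> b = a + 2 ^ l * t"
    then obtain l t where l: "2 ^ l \<le> Suc a" "Suc a < 2 ^ Suc l" and b: "b = a + 2 ^ l * t" by auto
    have "(2::nat) ^ l < 2 ^ Suc (length s)" "(2::nat) ^ length s < 2 ^ Suc l"
      using l string_code_bounds[of s] s by simp_all
    then have "l = length s" by (simp only: power_strict_increasing_iff)
    then have "b = string_code (s @ inv string_code t)"
      by (simp add: b s string_code_append string_code_decode)
    then show "code_prefix a b" by (simp add: s code_prefix_string_code)
  qed
qed

lemma code_prefix_le: "code_prefix a b \<Longrightarrow> a \<le> b"
  unfolding code_prefix_arith by auto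

lemma ex_code_prefix_ge: "\<exists>m\<ge>N. code_prefix n m"
proof -
  let ?s = "inv string_code n @ replicate N False"
  have "N \<le> string_code ?s" using length_le_string_code[of ?s] by simp
  moreover have "code_prefix n (string_code ?s)" by (simp add: code_prefix_def decode_string_code)
  ultimately show ?thesis by blast
qed

lemma computable_code_prefix:
  assumes "computable n A" "computable n B"
  shows "computable n (\<lambda>x v. of_bool (code_prefix (A x v) (B x v)))"
proof (rule computable_comp2[OF _ assms])
  show "computable (Suc (Suc 0)) (\<lambda>x v. of_bool (code_prefix (hd v) (hd (tl v))))"
    unfolding code_prefix_arith by (intro computable_logic)
qed

section \<open>The walk towards fewer colours\<close>

text \<open>Step \<open>i\<close> offers the string with code \<open>i\<close>, starting from the
  empty string. With \<open>d\<close> as a parameter, the true counts and their approximations drive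
  the same walk.\<close>

definition walk :: "(nat \<Rightarrow> nat) \<Rightarrow> nat \<Rightarrow> nat" where
  "walk d n = rec_nat 0 (\<lambda>i r. if code_prefix r i \<and> d i < d r then i else r) n"

lemma walk_0: "walk d 0 = 0"
  and walk_Suc: "walk d (Suc i) = (if code_prefix (walk d i) i \<and> d i < d (walk d i) then i else walk d i)"
  by (simp_all add: walk_def)

lemma walk_le: "walk d i \<le> i"
  by (induction i) (auto simp: walk_0 walk_Suc)

lemma walk_cong: "(\<And>n. n \<le> i \<Longrightarrow> d n = d' n) \<Longrightarrow> walk d i = walk d' i"
proof (induction i)
  case (Suc i)
  then show ?case using walk_le[of d' i] by (simp add: walk_Suc)
qed (simp add: walk_0)

lemma code_prefix_walk: "i \<le> j \<Longrightarrow> code_prefix (walk d i) (walk d j)"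
  by (induction j rule: dec_induct) (auto simp: walk_Suc code_prefix_refl intro: code_prefix_trans)

lemma walk_eq_or_less: "i \<le> j \<Longrightarrow> walk d j = walk d i \<or> d (walk d j) < d (walk d i)"
  by (induction j rule: dec_induct) (auto simp: walk_Suc)

text \<open>Every move strictly lowers \<open>d\<close>, so none happens after \<open>d\<close> is
  minimal along the walk.\<close>

lemma walk_stabilizes:
  obtains N where "\<forall>i\<ge>N. walk d i = walk d N"
proof -
  obtain N where N: "\<And>i. d (walk d N) \<le> d (walk d i)"
    using ex_has_least_nat[of "\<lambda>_. True" _ "\<lambda>i. d (walk d i)"] by auto
  have "walk d i = walk d N" if "N \<le> i" for i
    using walk_eq_or_less[OF that, of d] N[of i] by auto
  then show thesis using that by blast
qed

text \<open>The walk is offered \<open>n\<close> only once, possibly too early. But \<open>n\<close>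
  has extensions \<open>m\<close> offered after step \<open>N\<close>; since the walk stays put,
  their counts, and by \<open>anti\<close> also that of \<open>n\<close>, are not below the
  limit's.\<close>

lemma walk_limit_minimal:
  assumes lim: "\<forall>i\<ge>N. walk d i = walk d N"
    and anti: "\<And>m n. code_prefix m n \<Longrightarrow> d n \<le> d m"
    and "code_prefix (walk d N) n"
  shows "d (walk d N) \<le> d n"
proof -
  obtain m where m: "N \<le> m" "code_prefix n m" using ex_code_prefix_ge by blast
  then have "walk d (Suc m) = walk d N" "walk d m = walk d N" using lim le_SucI by blast+
  moreover have "code_prefix (walk d N) m" using assms(3) m by (blast intro: code_prefix_trans)
  ultimately have "\<not> d m < d (walk d N) \<or> m = walk d N" by (auto simp: walk_Suc split: if_splits)
  then show ?thesis using anti[OF m(2)] by auto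
qed

text \<open>If \<open>u\<close> is the least value of \<open>d\<close> on the walk points up to \<open>y\<close> that are prefixes of \<open>r\<close>, this
  is \<open>u - 1\<close> (for \<open>1 \<le> u \<le> k\<close>); the sum form makes it computable.\<close>

definition rank :: "(nat \<Rightarrow> nat) \<Rightarrow> nat \<Rightarrow> nat \<Rightarrow> nat \<Rightarrow> nat" where
  "rank d r k y = (\<Sum>c<k - 1. of_bool (\<forall>i<Suc y. code_prefix (walk d i) r \<longrightarrow> Suc c < d (walk d i)))"

lemma rank_cong:
  assumes "\<And>n. n \<le> y \<Longrightarrow> d n = d' n" shows "rank d r k y = rank d' r k y"
proof -
  have "walk d i = walk d' i \<and> d (walk d i) = d' (walk d' i)" if "i < Suc y" for i
    using that walk_cong[of i d d'] walk_le[of d i] assms by auto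
  then have "(\<forall>i<Suc y. code_prefix (walk d i) r \<longrightarrow> Suc c < d (walk d i)) \<longleftrightarrow>
      (\<forall>i<Suc y. code_prefix (walk d' i) r \<longrightarrow> Suc c < d' (walk d' i))" for c
    by metis
  then show ?thesis unfolding rank_def by simp
qed

lemma rank_less: "1 \<le> k \<Longrightarrow> rank d r k y < k"
proof -
  assume "1 \<le> k"
  have "rank d r k y \<le> (\<Sum>c<k - 1. 1)" unfolding rank_def by (intro sum_mono) simp
  then show ?thesis using \<open>1 \<le> k\<close> by simp
qed

text \<open>Along the walk its limit \<open>b\<close> alone attains the least count, so the minimum
  over inspected points is \<open>d b\<close> exactly when \<open>b\<close> is inspected. In the
  first claim \<open>N \<le> y\<close> ensures that \<open>b\<close> was visited; the second holds
  for every \<open>y\<close>, so even an early \<open>y\<close> can be trusted.\<close>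

lemma rank_limit:
  assumes lim: "\<forall>i\<ge>N. walk d i = walk d N"
    and b: "1 \<le> d (walk d N)" and k: "d 0 \<le> k"
  shows "N \<le> y \<Longrightarrow> code_prefix (walk d N) r \<Longrightarrow> rank d r k y = d (walk d N) - 1"
    and "rank d r k y = d (walk d N) - 1 \<Longrightarrow> code_prefix (walk d N) r"
proof -
  define b where "b = walk d N"
  have min: "walk d i = b \<or> d b < d (walk d i)" for i
    using walk_eq_or_less[of i "max i N" d] lim[rule_format, of "max i N"] by (auto simp: b_def)
  have "d b \<le> k" using min[of 0] k by (auto simp: walk_0)
  have count: "(\<Sum>c<k - 1. of_bool (c < u) :: nat) = min u (k - 1)" for u
  proof -
    have "{..<k - 1} \<inter> {c. c < u} = {..<min u (k - 1)}" by auto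
    then show ?thesis by (simp add: sum_of_bool_eq)
  qed
  {
    assume y: "N \<le> y" and r: "code_prefix (walk d N) r"
    have "(\<forall>i<Suc y. code_prefix (walk d i) r \<longrightarrow> Suc c < d (walk d i)) \<longleftrightarrow> c < d b - 1" for c
    proof
      assume "\<forall>i<Suc y. code_prefix (walk d i) r \<longrightarrow> Suc c < d (walk d i)"
      then have "Suc c < d b" using y r by (simp add: b_def)
      then show "c < d b - 1" by simp
    next
      assume "c < d b - 1"
      then have "Suc c < d (walk d i)" for i using min[of i] by auto
      then show "\<forall>i<Suc y. code_prefix (walk d i) r \<longrightarrow> Suc c < d (walk d i)" by blast
    qed
    \<comment> \<open>Since \<open>d b \<le> k\<close>, the cutoff \<open>k - 1\<close> does not
      lower \<open>d b - 1\<close>.\<close>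
    then have "rank d r k y = min (d b - 1) (k - 1)" by (simp only: rank_def count)
    then show "rank d r k y = d (walk d N) - 1" using \<open>d b \<le> k\<close> by (simp add: b_def)
  }
  {
    assume eq: "rank d r k y = d (walk d N) - 1"
    show "code_prefix (walk d N) r"
    proof (rule ccontr)
      assume n: "\<not> code_prefix (walk d N) r"
      have less: "d b < d (walk d i)" if "code_prefix (walk d i) r" for i
        using min[of i] that n by (auto simp: b_def)
      \<comment> \<open>The walk starts at the empty string, a prefix of \<open>r\<close>. So the
        cutoff \<open>k - 1\<close> leaves \<open>d b\<close> intact, and the sum is too
        large.\<close>
      have "d b < k" using less[of 0] k by (simp add: walk_0 code_prefix_0)
      have "(\<Sum>c<k - 1. of_bool (c < d b)) \<le> rank d r k y"
        unfolding rank_def using less by (intro sum_mono) (auto simp: of_bool_def intro: Suc_leI[THEN le_less_trans])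
      then have "min (d b) (k - 1) \<le> rank d r k y" by (simp only: count)
      then show False using eq b \<open>d b < k\<close> by (simp add: b_def)
    qed
  }
qed

section \<open>Colour counts and the \<open>D2\<close>-instance\<close>

definition colors_seen :: "(nat \<Rightarrow> nat) \<Rightarrow> nat \<Rightarrow> nat \<Rightarrow> nat \<Rightarrow> nat" where
  "colors_seen f k s n = (\<Sum>c<k. of_bool (\<exists>m<Suc s. code_prefix n m \<and> f m = c))"

definition colors_above :: "(nat \<Rightarrow> nat) \<Rightarrow> nat \<Rightarrow> nat \<Rightarrow> nat" where
  "colors_above f k n = (\<Sum>c<k. of_bool (\<exists>m. code_prefix n m \<and> f m = c))"

text \<open>The computable sequence \<open>r y\<close>: here \<open>y\<close> is both the stage of
  the counts and the length of the walk.\<close>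

definition node :: "(nat \<Rightarrow> nat) \<Rightarrow> nat \<Rightarrow> nat \<Rightarrow> nat" where
  "node f k y = walk (colors_seen f k y) y"

lemma eventually_colors_seen: "\<forall>\<^sub>F s in sequentially. colors_seen f k s n = colors_above f k n"
proof -
  have "\<forall>\<^sub>F s in sequentially. (\<exists>m<Suc s. code_prefix n m \<and> f m = c) \<longleftrightarrow> (\<exists>m. code_prefix n m \<and> f m = c)" for c
  proof (cases "\<exists>m. code_prefix n m \<and> f m = c")
    case True
    then obtain m where "code_prefix n m" "f m = c" by blast
    then have "\<exists>m<Suc s. code_prefix n m \<and> f m = c" if "m \<le> s" for s
      using that by (intro exI[of _ m]) simp
    then show ?thesis
      by (intro eventually_mono[OF eventually_ge_at_top[of m]]) blast
  next
    case False
    then have "(\<exists>m<Suc s. code_prefix n m \<and> f m = c) \<longleftrightarrow> (\<exists>m. code_prefix n m \<and> f m = c)" for s by blast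
    then show ?thesis by simp
  qed
  then have "\<forall>\<^sub>F s in sequentially. \<forall>c\<in>{..<k}.
      (\<exists>m<Suc s. code_prefix n m \<and> f m = c) \<longleftrightarrow> (\<exists>m. code_prefix n m \<and> f m = c)"
    by (intro eventually_ball_finite) auto
  then show ?thesis
    by (rule eventually_mono) (auto simp: colors_seen_def colors_above_def intro!: sum.cong)
qed

lemma eventually_colors_seen_le: "\<forall>\<^sub>F s in sequentially. \<forall>n\<le>y. colors_seen f k s n = colors_above f k n"
proof -
  have "\<forall>\<^sub>F s in sequentially. \<forall>n\<in>{..y}. colors_seen f k s n = colors_above f k n"
    by (intro eventually_ball_finite ballI eventually_colors_seen) simp
  then show ?thesis by (simp add: Ball_def)
qed

lemma colors_above_antimono: "code_prefix m n \<Longrightarrow> colors_above f k n \<le> colors_above f k m"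
  unfolding colors_above_def by (intro sum_mono) (auto intro: code_prefix_trans)

lemma colors_above_le: "colors_above f k n \<le> k"
proof -
  have "colors_above f k n \<le> (\<Sum>c<k. 1)" unfolding colors_above_def by (intro sum_mono) simp
  then show ?thesis by simp
qed

lemma colors_above_pos:
  assumes "f n < k" shows "1 \<le> colors_above f k n"
proof -
  have "of_bool (\<exists>m. code_prefix n m \<and> f m = f n) \<le> colors_above f k n"
    unfolding colors_above_def using assms by (intro member_le_sum) auto
  moreover have "\<exists>m. code_prefix n m \<and> f m = f n" using code_prefix_refl by blast
  ultimately show ?thesis by simp
qed

text \<open>Colours above \<open>n\<close> also occur above \<open>m\<close>, so equal counts force
  equal sets of colours.\<close>

lemma colors_above_eq_imp:
  assumes "code_prefix m n" "colors_above f k m \<le> colors_above f k n" "code_prefix m i" "f i < k"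
  shows "\<exists>j. code_prefix n j \<and> f j = f i"
proof -
  have eq: "colors_above f k n = colors_above f k m"
    using assms(2) colors_above_antimono[OF assms(1), of f k] by simp
  have "of_bool (\<exists>j. code_prefix n j \<and> f j = c) \<le> (of_bool (\<exists>j. code_prefix m j \<and> f j = c) :: nat)" for c
    using assms(1) by (auto intro: code_prefix_trans)
  from sum_mono_inv[OF eq[unfolded colors_above_def] this, of "f i"]
  have "of_bool (\<exists>j. code_prefix n j \<and> f j = f i) = (of_bool (\<exists>j. code_prefix m j \<and> f j = f i) :: nat)"
    using assms(4) by simp
  then show ?thesis using assms(3) by (auto simp: of_bool_eq_iff)
qed

text \<open>The \<open>D2\<close>-instance, with \<open>s\<close> as limit variable. The string is
  frozen at stage \<open>y\<close>; only the counts used for ranking improve with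
  \<open>s\<close>.\<close>

definition mark :: "(nat \<Rightarrow> nat) \<Rightarrow> nat \<Rightarrow> nat \<Rightarrow> nat \<Rightarrow> nat" where
  "mark f k y s = rank (colors_seen f k s) (node f k y) k y"

lemma mark_less: "1 \<le> k \<Longrightarrow> mark f k y s < k"
  unfolding mark_def by (rule rank_less)

text \<open>\<open>rank\<close> consults counts only at codes up to \<open>y\<close>, and these
  finitely many counts are eventually correct.\<close>

lemma eventually_mark: "\<forall>\<^sub>F s in sequentially. mark f k y s = rank (colors_above f k) (node f k y) k y"
  using eventually_colors_seen_le[of y f k] unfolding mark_def
  by (rule eventually_mono) (auto intro: rank_cong)

lemma LIMSEQ_mark: "(\<lambda>s. mark f k y s) \<longlonglongrightarrow> rank (colors_above f k) (node f k y) k y"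
  using eventually_mark by (rule tendsto_eventually)

text \<open>Late elements of \<open>M\<close> identify \<open>i\<close> as the count at the limit of
  the true walk, minus one. Hence the node of every \<open>y\<close> in \<open>M\<close> extends
  that limit, above which no string loses a colour.\<close>

lemma dense_node:
  assumes f: "\<And>n. f n < k" and M: "infinite M"
    and i: "\<And>y. y \<in> M \<Longrightarrow> lim (\<lambda>s. mark f k y s) = i" and y: "y \<in> M" and n: "code_prefix (node f k y) n"
  shows "\<exists>m. code_prefix n m \<and> f m = f (node f k y)"
proof -
  let ?d = "colors_above f k"
  obtain N where lim: "\<forall>i\<ge>N. walk ?d i = walk ?d N" by (rule walk_stabilizes)
  define b where "b = walk ?d N"
  note limit = rank_limit[of N ?d, OF lim colors_above_pos[of f, OF f] colors_above_le, folded b_def]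
  have "\<forall>\<^sub>F y in sequentially. N \<le> y \<and> (\<forall>n\<le>N. colors_seen f k y n = ?d n)"
    using eventually_colors_seen_le[of N f k] eventually_ge_at_top[of N] by eventually_elim simp
  then obtain Y where Y: "\<And>y. Y \<le> y \<Longrightarrow> N \<le> y \<and> (\<forall>n\<le>N. colors_seen f k y n = ?d n)"
    unfolding eventually_sequentially by blast
  have late: "rank ?d (node f k y) k y = ?d b - 1" if "Y \<le> y" for y
  proof (rule limit(1))
    \<comment> \<open>Counts at codes up to \<open>N\<close> are already correct at stage
      \<open>y\<close>, so the approximate walk passes through \<open>b\<close> and then only
      extends it.\<close>
    have "walk (colors_seen f k y) N = b" unfolding b_def using Y[OF that] by (intro walk_cong) simp
    then show "code_prefix b (node f k y)"
      using code_prefix_walk[of N y "colors_seen f k y"] Y[OF that] by (simp add: node_def)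
  qed (use Y[OF that] in blast)
  have rank: "rank ?d (node f k y) k y = i" if "y \<in> M" for y
    using i[OF that] limI[OF LIMSEQ_mark] by simp
  \<comment> \<open>\<open>z\<close> is late, hence of rank \<open>?d b - 1\<close>, and in
    \<open>M\<close>, hence of the same rank as \<open>y\<close>.\<close>
  obtain z where "Y \<le> z" "z \<in> M" using M unfolding finite_nat_set_iff_bounded_le by (meson nat_le_linear)
  then have "rank ?d (node f k y) k y = ?d b - 1" using late[of z] rank[of z] rank[OF y] by simp
  then have b: "code_prefix b (node f k y)" by (rule limit(2))
  have "code_prefix b n" using b n by (rule code_prefix_trans)
  moreover have "?d b \<le> ?d n"
    unfolding b_def
    using lim colors_above_antimono \<open>code_prefix b n\<close>[unfolded b_def] by (rule walk_limit_minimal)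
  ultimately show ?thesis using b f by (rule colors_above_eq_imp)
qed

section \<open>Greedy monochromatic trees\<close>

definition child :: "nat \<Rightarrow> bool \<Rightarrow> nat" where
  "child a b = string_code (inv string_code a @ [b])"

lemma code_prefix_child: "code_prefix a (child a b)"
  by (simp add: child_def code_prefix_def decode_string_code)

lemma child_ne: "child a b \<noteq> a"
  by (metis append_self_conv child_def decode_string_code not_Cons_self2)

lemma code_prefix_strict: "code_prefix a j \<Longrightarrow> j \<noteq> a \<Longrightarrow> \<exists>b. code_prefix (child a b) j"
proof -
  assume "code_prefix a j" "j \<noteq> a"
  then obtain u where u: "inv string_code j = inv string_code a @ u" "u \<noteq> []"
    unfolding code_prefix_def by (metis append_Nil2 prefix_def string_code_decode)
  then show ?thesis by (cases u) (auto simp: child_def code_prefix_def decode_string_code)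
qed

lemma code_prefix_child_unique: "code_prefix (child a b) n \<Longrightarrow> code_prefix (child a c) n \<Longrightarrow> b = c"
  by (auto simp: child_def code_prefix_def decode_string_code prefix_def)

definition next_node :: "(nat \<Rightarrow> nat) \<Rightarrow> nat \<Rightarrow> nat \<Rightarrow> nat" where
  "next_node f c n = (LEAST m. code_prefix n m \<and> f m = c)"

definition embed :: "(nat \<Rightarrow> nat) \<Rightarrow> nat \<Rightarrow> nat \<Rightarrow> bool list \<Rightarrow> nat" where
  "embed f c r s = foldl (\<lambda>a b. next_node f c (child a b)) r s"

text \<open>A step from \<open>a\<close> towards \<open>n\<close>: the \<open>j\<close> expresses that \<open>m\<close> and \<open>n\<close> extend the same child of \<open>a\<close>.
  The value \<open>Suc n\<close> signals failure, since no code above \<open>n\<close> is a prefix of \<open>n\<close>.\<close>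

definition greedy_step :: "(nat \<Rightarrow> nat) \<Rightarrow> nat \<Rightarrow> nat \<Rightarrow> nat \<Rightarrow> nat" where
  "greedy_step f c n a =
    (LEAST m. m = Suc n \<or> (\<exists>j<Suc n. j \<noteq> a \<and> code_prefix a j \<and> code_prefix j n \<and> code_prefix j m) \<and> f m = c)"

text \<open>Decides membership of \<open>n\<close> in the greedy tree by descending from
  \<open>r\<close> towards \<open>n\<close>. Codes grow at every level, so \<open>n\<close> steps
  suffice.\<close>

definition reached :: "(nat \<Rightarrow> nat) \<Rightarrow> nat \<Rightarrow> nat \<Rightarrow> nat \<Rightarrow> bool" where
  "reached f c r n \<longleftrightarrow> (\<exists>i<Suc n. rec_nat r (\<lambda>_ a. greedy_step f c n a) i = n)"

lemma Least_bounded: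
  fixes N :: nat
  assumes "\<exists>m. P m" shows "(LEAST m. m = N \<or> P m) = min N (LEAST m. P m)"
proof (rule Least_equality)
  show "min N (LEAST m. P m) = N \<or> P (min N (LEAST m. P m))"
    using LeastI_ex[OF assms] by (auto simp: min_def)
  show "min N (LEAST m. P m) \<le> m" if "m = N \<or> P m" for m
    using that Least_le[of P m] by auto
qed

lemma greedy_step_out:
  assumes "\<And>b. \<not> code_prefix (child a b) n" shows "greedy_step f c n a = Suc n"
proof -
  have "\<not> (j \<noteq> a \<and> code_prefix a j \<and> code_prefix j n)" for j
    using assms code_prefix_strict[of a j] by (blast intro: code_prefix_trans)
  then show ?thesis
    unfolding greedy_step_def by (intro Least_equality) blast+
qed

section \<open>The greedy embedding and its decidable range\<close>

context
  fixes f :: "nat \<Rightarrow> nat" and r c :: nat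
  assumes r: "f r = c" and dense: "\<And>n. code_prefix r n \<Longrightarrow> \<exists>m. code_prefix n m \<and> f m = c"
begin

lemma next_node: "code_prefix r n \<Longrightarrow> code_prefix n (next_node f c n) \<and> f (next_node f c n) = c"
  unfolding next_node_def by (rule LeastI_ex) (rule dense)

lemma greedy_step_child:
  assumes "code_prefix r a" "code_prefix (child a b) n"
  shows "greedy_step f c n a = min (Suc n) (next_node f c (child a b))"
proof -
  \<comment> \<open>All proper extensions of \<open>a\<close> that are prefixes of \<open>n\<close>
    pass through the same child; conversely that child serves as \<open>j\<close>.\<close>
  have "(\<exists>j<Suc n. j \<noteq> a \<and> code_prefix a j \<and> code_prefix j n \<and> code_prefix j m) \<longleftrightarrow> code_prefix (child a b) m" for m
  proof
    assume "\<exists>j<Suc n. j \<noteq> a \<and> code_prefix a j \<and> code_prefix j n \<and> code_prefix j m"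
    then obtain j where j: "j \<noteq> a" "code_prefix a j" "code_prefix j n" "code_prefix j m" by blast
    then obtain d where d: "code_prefix (child a d) j" using code_prefix_strict by blast
    then have "code_prefix (child a d) n" using j by (blast intro: code_prefix_trans)
    then have "d = b" using assms(2) by (rule code_prefix_child_unique)
    then show "code_prefix (child a b) m" using d j by (blast intro: code_prefix_trans)
  next
    assume "code_prefix (child a b) m"
    then show "\<exists>j<Suc n. j \<noteq> a \<and> code_prefix a j \<and> code_prefix j n \<and> code_prefix j m"
      using assms(2) code_prefix_le[OF assms(2)] code_prefix_child[of a b] child_ne[of a b]
      by (intro exI[of _ "child a b"]) simp
  qed
  then have "greedy_step f c n a = (LEAST m. m = Suc n \<or> code_prefix (child a b) m \<and> f m = c)"
    by (simp add: greedy_step_def)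
  also have "\<dots> = min (Suc n) (next_node f c (child a b))"
    unfolding next_node_def using dense[of "child a b"] assms(1) code_prefix_child[of a b]
    by (intro Least_bounded) (blast intro: code_prefix_trans)
  finally show ?thesis .
qed

abbreviation (input) "h \<equiv> embed f c r"

lemma embed_Nil: "h [] = r"
  and embed_snoc: "h (s @ [b]) = next_node f c (child (h s) b)"
  by (simp_all add: embed_def)

lemma embed_above: "code_prefix r (h s) \<and> f (h s) = c"
proof (induction s rule: rev_induct)
  case Nil
  then show ?case by (simp add: embed_Nil code_prefix_refl r)
next
  case (snoc b s)
  then have "code_prefix r (child (h s) b)" using code_prefix_child code_prefix_trans by blast
  from next_node[OF this] this show ?case by (auto simp: embed_snoc intro: code_prefix_trans)
qed

lemma code_prefix_embed_snoc: "code_prefix (child (h s) b) (h (s @ [b]))"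
  unfolding embed_snoc using next_node embed_above[of s] code_prefix_child[of "h s" b] by (blast intro: code_prefix_trans)

lemma code_prefix_embed_append: "code_prefix (h s) (h (s @ t))"
proof (induction t rule: rev_induct)
  case (snoc b t)
  then show ?case
    using code_prefix_embed_snoc[of "s @ t" b] code_prefix_child[of "h (s @ t)" b] by (auto intro: code_prefix_trans)
qed (simp add: code_prefix_refl)

lemma code_prefix_embed_Cons: "code_prefix (child (h s) b) (h (s @ b # t))"
  using code_prefix_embed_snoc[of s b] code_prefix_embed_append[of "s @ [b]" t] by (auto intro: code_prefix_trans)

text \<open>Images grow properly along a branch, and if \<open>s\<close> and \<open>t\<close> split
  after \<open>p\<close>, their images extend different children of \<open>h p\<close>, which have
  no common extension.\<close>

lemma code_prefix_embed_iff: "code_prefix (h s) (h t) \<longleftrightarrow> prefix s t"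
proof
  show "code_prefix (h s) (h t)" if "prefix s t" using that code_prefix_embed_append by (auto simp: prefix_def)
  show "prefix s t" if le: "code_prefix (h s) (h t)"
  proof (rule ccontr)
    assume n: "\<not> prefix s t"
    show False
    proof (cases "prefix t s")
      case True
      with n obtain b u where "s = t @ b # u" by (auto simp: prefix_def neq_Nil_conv)
      then have "code_prefix (child (h t) b) (h t)" using code_prefix_embed_Cons le by (blast intro: code_prefix_trans)
      then show False using code_prefix_le code_prefix_child child_ne by (metis le_antisym)
    next
      case False
      with n have "s \<parallel> t" by blast
      from parallel_decomp[OF this] obtain p b d u v
        where bd: "b \<noteq> d" and s: "s = p @ b # u" and t: "t = p @ d # v" by blast
      have "code_prefix (child (h p) b) (h t)" using code_prefix_embed_Cons le unfolding s by (blast intro: code_prefix_trans)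
      moreover have "code_prefix (child (h p) d) (h t)" using code_prefix_embed_Cons unfolding t .
      ultimately show False using bd code_prefix_child_unique by blast
    qed
  qed
qed

text \<open>Each level raises the code; this justifies the step bound in
  \<open>reached\<close>.\<close>

lemma length_le_embed: "length s \<le> h s"
proof (induction s rule: rev_induct)
  case (snoc b s)
  have "h s < child (h s) b" using code_prefix_le[OF code_prefix_child] child_ne by (metis le_neq_implies_less)
  also have "\<dots> \<le> h (s @ [b])" using code_prefix_le[OF code_prefix_embed_snoc] .
  finally show ?case using snoc by simp
qed simp

lemma reached_iff: "reached f c r n \<longleftrightarrow> n \<in> range h"
proof
  let ?it = "\<lambda>i. rec_nat r (\<lambda>_ a. greedy_step f c n a) i"
  {
    assume "reached f c r n"
    then obtain i where "?it i = n" unfolding reached_def by blast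
    \<comment> \<open>The descent stays in the tree until it takes the failure value, which differs
      from \<open>n\<close>.\<close>
    moreover have "?it i \<in> range h \<or> ?it i = Suc n" for i
    proof (induction i)
      case 0
      show ?case using embed_Nil[symmetric] by auto
    next
      case (Suc i)
      show ?case
      proof (cases "\<exists>b. code_prefix (child (?it i) b) n")
        \<comment> \<open>This includes an iterate equal to \<open>Suc n\<close>, so failure
          persists.\<close>
        case False
        then show ?thesis using greedy_step_out[of "?it i" n f c] by simp
      next
        case True
        then obtain b where b: "code_prefix (child (?it i) b) n" by blast
        then have "?it i \<le> n" using code_prefix_child code_prefix_le by (meson le_trans)
        with Suc obtain s where s: "?it i = h s" by auto
        have "greedy_step f c n (h s) = min (Suc n) (h (s @ [b]))"
          using greedy_step_child embed_above b unfolding s embed_snoc by blast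
        then show ?thesis by (auto simp: s min_def)
      qed
    qed
    ultimately show "n \<in> range h" by (metis n_not_Suc_n)
  }
  {
    assume "n \<in> range h"
    then obtain s where n: "n = h s" by blast
    \<comment> \<open>The descent visits the images of the initial segments of \<open>s\<close>;
      their codes are at most \<open>n\<close>, so the search bound never interferes.\<close>
    have "?it i = h (take i s)" if "i \<le> length s" for i
      using that
    proof (induction i)
      case 0
      show ?case by (simp add: embed_Nil)
    next
      case (Suc i)
      then have i: "i < length s" and it: "?it i = h (take i s)" by simp_all
      have take: "take (Suc i) s = take i s @ [s ! i]" using i by (simp add: take_Suc_conv_app_nth)
      have le: "code_prefix (h (take (Suc i) s)) n" unfolding n code_prefix_embed_iff by (rule take_is_prefix)
      have "code_prefix (child (h (take i s)) (s ! i)) n"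
        using code_prefix_embed_snoc[of "take i s" "s ! i"] le unfolding take by (rule code_prefix_trans)
      then have "?it (Suc i) = min (Suc n) (h (take (Suc i) s))"
        using greedy_step_child embed_above it take embed_snoc by simp
      then show ?case using code_prefix_le[OF le] by simp
    qed
    from this[of "length s"] show "reached f c r n"
      unfolding reached_def using length_le_embed[of s] n by (intro exI[of _ "length s"]) simp
  }
qed

lemma reached_solution:
  "\<exists>H. full_binary_subtree H \<and> (\<forall>s\<in>H. f (string_code s) = c) \<and>
    (\<lambda>n. of_bool (reached f c r n)) = (indicator (string_code ` H) :: nat \<Rightarrow> nat)"
proof (intro exI conjI)
  let ?g = "\<lambda>s. inv string_code (h s)"
  have iso: "prefix (?g s) (?g t) \<longleftrightarrow> prefix s t" for s t
    using code_prefix_embed_iff by (simp add: code_prefix_def)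
  have "inj ?g"
    by (rule injI) (metis iso prefix_order.antisym prefix_order.order_refl)
  then show "full_binary_subtree (range ?g)"
    unfolding full_binary_subtree_def using iso by (blast intro: inj_on_imp_bij_betw)
  show "\<forall>s\<in>range ?g. f (string_code s) = c"
    using embed_above by (auto simp: string_code_decode)
  have "string_code ` range ?g = range h" by (simp add: image_image string_code_decode)
  then show "(\<lambda>n. of_bool (reached f c r n)) = (indicator (string_code ` range ?g) :: nat \<Rightarrow> nat)"
    by (auto simp: reached_iff indicator_def)
qed

end

section \<open>Computability of the reduction\<close>

text \<open>The colouring \<open>f x\<close> is read off the oracle: it is the oracle itself in the
  forward functional and the even half of a join in the backward one.\<close>

context
  fixes f :: "(nat \<Rightarrow> nat) \<Rightarrow> nat \<Rightarrow> nat"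
  assumes f: "\<And>n A. computable n A \<Longrightarrow> computable n (\<lambda>x v. f x (A x v))"
begin

lemma computable_colors_seen:
  assumes "computable n A" "computable n B"
  shows "computable n (\<lambda>x v. colors_seen (f x) k (A x v) (B x v))"
proof (rule computable_comp2[OF _ assms])
  show "computable (Suc (Suc 0)) (\<lambda>x v. colors_seen (f x) k (hd v) (hd (tl v)))"
    unfolding colors_seen_def by (intro computable_logic f computable_code_prefix)
qed

lemma computable_walk_colors_seen:
  assumes "computable n A" "computable n B"
  shows "computable n (\<lambda>x v. walk (colors_seen (f x) k (A x v)) (B x v))"
proof (rule computable_comp2[OF _ assms])
  show "computable (Suc (Suc 0)) (\<lambda>x v. walk (colors_seen (f x) k (hd v)) (hd (tl v)))"
    unfolding walk_def by (intro computable_logic computable_rec_nat computable_colors_seen computable_code_prefix)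
qed

lemma computable_node:
  assumes "computable n A" shows "computable n (\<lambda>x v. node (f x) k (A x v))"
  unfolding node_def by (intro computable_walk_colors_seen assms)

lemma computable_mark:
  assumes "computable n A" "computable n B"
  shows "computable n (\<lambda>x v. mark (f x) k (A x v) (B x v))"
proof (rule computable_comp2[OF _ assms])
  show "computable (Suc (Suc 0)) (\<lambda>x v. mark (f x) k (hd v) (hd (tl v)))"
    unfolding mark_def rank_def
    by (intro computable_logic computable_walk_colors_seen computable_colors_seen computable_code_prefix computable_node)
qed

lemma computable_reached:
  assumes "computable n A" "computable n B" "computable n C"
  shows "computable n (\<lambda>x v. of_bool (reached (f x) (A x v) (B x v) (C x v)))"
proof (rule computable_comp3[OF _ assms])
  show "computable (Suc (Suc (Suc 0)))
      (\<lambda>x v. of_bool (reached (f x) (hd v) (hd (tl v)) (hd (tl (tl v)))))"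
    unfolding reached_def greedy_step_def
    by (intro computable_logic computable_rec_nat computable_code_prefix f)
qed

end

theorem theorem4p8:
  fixes k :: nat
  assumes "k \<ge> 1"
  shows "TT1 k \<le>\<^sub>W D2 k"
proof -
  \<comment> \<open>Forward functional: position \<open>prod_encode (y, s)\<close> holds the stage
    \<open>s\<close> approximation to the colour of \<open>y\<close>.\<close>
  have "computable (Suc 0) (\<lambda>x v. mark x k (fst (prod_decode (hd v))) (snd (prod_decode (hd v))))"
    by (intro computable_mark computable_prod_decode computable_logic)
  then obtain p where "\<And>x v. length v = Suc 0 \<Longrightarrow> oeval p x v =
      Some (mark x k (fst (prod_decode (hd v))) (snd (prod_decode (hd v))))"
    unfolding computable_def by blast
  from this[of "[_]"] have p: "oeval p x [n] =
      Some (mark x k (fst (prod_decode n)) (snd (prod_decode n)))" for x n by simp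
  let ?f = "\<lambda>(x :: nat \<Rightarrow> nat) i. x (i + i)"
  have f: "computable n (\<lambda>x v. ?f x (A x v))" if "computable n A" for n A
    by (intro computable_logic that)
  \<comment> \<open>The greedy tree is rooted at the node of \<open>m\<close> and uses the colour of
    that root.\<close>
  let ?G = "\<lambda>x m n. of_bool (reached (?f x) (?f x (node (?f x) k m)) (node (?f x) k m) n)"
  \<comment> \<open>Backward functional: the search through the odd positions of the join finds the
    least element of the \<open>D2\<close>-solution.\<close>
  have "\<exists>q. \<forall>x v. length v = Suc 0 \<longrightarrow> (\<exists>m. x (Suc (m + m)) = 1) \<longrightarrow>
      oeval q x v = Some (?G x (LEAST m. x (Suc (m + m)) = 1) (hd v))"
    by (rule partial_Least[where P = "\<lambda>x m v. x (Suc (m + m)) = 1"])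
      (intro computable_logic computable_reached[of ?f] computable_node[of ?f] f)+
  then obtain q where "\<And>x v. length v = Suc 0 \<Longrightarrow> \<exists>m. x (Suc (m + m)) = 1 \<Longrightarrow>
      oeval q x v = Some (?G x (LEAST m. x (Suc (m + m)) = 1) (hd v))"
    by blast
  from this[of "[_]"] have q: "oeval q x [n] = Some (?G x (LEAST m. x (Suc (m + m)) = 1) n)"
    if "\<exists>m. x (Suc (m + m)) = 1" for x n
    using that by simp
  show ?thesis
    unfolding weihrauch_le_def
  proof (intro exI ballI)
    fix x assume "x \<in> instances (TT1 k)"
    then have x: "x n < k" for n
      using string_code_decode[of n] by (metis (no_types, lifting) TT1_def mem_Collect_eq problem.select_convs(1))
    define z where "z n = mark x k (fst (prod_decode n)) (snd (prod_decode n))" for n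
    have z: "z (prod_encode (y, s)) = mark x k y s" for y s by (simp add: z_def)
    show "\<exists>z\<in>instances (D2 k). functional_value p x z \<and>
        (\<forall>y\<in>solutions (D2 k) z. \<exists>w\<in>solutions (TT1 k) x. functional_value q (join x y) w)"
    proof (rule bexI[of _ z], intro conjI ballI)
      show "functional_value p x z" by (simp add: functional_value_def p z_def)
      show "z \<in> instances (D2 k)"
        using mark_less[OF assms] convergentI[OF LIMSEQ_mark] by (auto simp: D2_def z)
      fix y assume "y \<in> solutions (D2 k) z"
      then obtain M i where y: "y = indicator M" and M: "infinite M"
        and i: "\<And>a. a \<in> M \<Longrightarrow> lim (\<lambda>b. mark x k a b) = i"
        by (auto simp: D2_def z)
      define m where "m = (LEAST m. join x y (Suc (m + m)) = 1)"
      have join: "join x y (i + i) = x i" "join x y (Suc (i + i)) = indicator M i" for i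
        by (simp_all add: join_def y flip: mult_2)
      \<comment> \<open>\<open>M\<close> is infinite, hence nonempty, so the search
        terminates.\<close>
      have ex: "\<exists>m. join x y (Suc (m + m)) = 1"
        using M unfolding join by (metis finite.emptyI indicator_simps(1) ex_in_conv)
      then have "join x y (Suc (m + m)) = 1" unfolding m_def by (rule LeastI_ex)
      then have "m \<in> M" unfolding join by (cases "m \<in> M") simp_all
      then have dense: "\<exists>l. code_prefix n l \<and> x l = x (node x k m)" if "code_prefix (node x k m) n" for n
        using dense_node[of x k, OF x M i _ that] by blast
      let ?w = "\<lambda>n. of_bool (reached x (x (node x k m)) (node x k m) n)"
      show "\<exists>w\<in>solutions (TT1 k) x. functional_value q (join x y) w"
      proof (rule bexI[of _ ?w])
        show "functional_value q (join x y) ?w"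
          using q[OF ex] unfolding m_def[symmetric] unfolding functional_value_def join by simp
        show "?w \<in> solutions (TT1 k) x"
          using reached_solution[OF refl dense] by (auto simp: TT1_def)
      qed
    qed
  qed
qed

end
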